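(* Let $X$ be a completely metrizable space and suppose that $wt(X) = \aleph_n$ for some $n \in \omega \setminus \{0\}$. Then $\mathfrak{cov}(X) = \mathfrak{par}(X) = \aleph_n$.
   Context: A Polish space is a separable completely metrizable space. The weight $wt(X)$ of a topological space $X$ is the least cardinality of a basis for $X$. For a completely metrizable space $X$, $\mathfrak{cov}(X)$ denotes the smallest cardinality of a family $\mathcal{C}$ of subspaces of $X$, each of which is Polish, with $\bigcup \mathcal{C} = X$; and $\mathfrak{par}(X)$ denotes the smallest cardinality of a partition of $X$ (a family of pairwise disjoint sets with union $X$) into Polish subspaces. *)

theory Defs
  imports "HOL-Analysis.Analysis"
begin

unbundle cardinal_syntax
no_notation Set_Algebras.elt_set_eq (infix \<open>=o\<close> 50)

text \<open>
  Cardinal numbers are represented as in the library, by cardinal orders (relations \<open>r\<close> with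
  \<open>Card_order r\<close>), which are compared by \<open>=o\<close>, \<open>\<le>o\<close> and \<open><o\<close>, also across types.

  The least cardinality of a set with property \<open>P\<close>. It is meaningful as soon as some set
  satisfies \<open>P\<close>; see \<open>least_card_attained\<close> and \<open>least_card_le\<close>.
\<close>
definition least_card :: "('b set \<Rightarrow> bool) \<Rightarrow> 'b rel" where
  "least_card P = |SOME A. P A \<and> (\<forall>B. P B \<longrightarrow> |A| \<le>o |B| )|"

definition base_of :: "'a topology \<Rightarrow> 'a set set \<Rightarrow> bool" where
  "base_of X \<B> \<longleftrightarrow> (\<forall>V \<in> \<B>. openin X V) \<and>
     (\<forall>U x. openin X U \<and> x \<in> U \<longrightarrow> (\<exists>V \<in> \<B>. x \<in> V \<and> V \<subseteq> U))"

definition weight :: "'a topology \<Rightarrow> 'a set rel" where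
  "weight X = least_card (base_of X)"

definition Polish_space :: "'a topology \<Rightarrow> bool" where
  "Polish_space X \<longleftrightarrow> separable_space X \<and> completely_metrizable_space X"

definition Polish_cover :: "'a topology \<Rightarrow> 'a set set \<Rightarrow> bool" where
  "Polish_cover X \<C> \<longleftrightarrow>
     (\<forall>C \<in> \<C>. C \<subseteq> topspace X \<and> Polish_space (subtopology X C)) \<and> \<Union>\<C> = topspace X"

definition Polish_partition :: "'a topology \<Rightarrow> 'a set set \<Rightarrow> bool" where
  "Polish_partition X \<P> \<longleftrightarrow> Polish_cover X \<P> \<and> disjoint \<P>"

definition cov :: "'a topology \<Rightarrow> 'a set rel" where
  "cov X = least_card (Polish_cover X)"

definition par :: "'a topology \<Rightarrow> 'a set rel" where
  "par X = least_card (Polish_partition X)"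

text \<open>
  \<open>is_aleph n r\<close> says that the cardinal \<open>r\<close> is \<open>\<aleph>\<^sub>n\<close>. It is a predicate since the iterated
  successor \<open>cardSuc\<close> of \<open>natLeq\<close> would live in a type depending on \<open>n\<close>. That the predecessor
  \<open>s\<close> is taken in the type of \<open>r\<close> is no restriction; see \<open>is_aleph_cardSuc\<close>.
\<close>
primrec is_aleph :: "nat \<Rightarrow> 'b rel \<Rightarrow> bool" where
  "is_aleph 0 r \<longleftrightarrow> r =o natLeq"
| "is_aleph (Suc n) r \<longleftrightarrow> (\<exists>s :: 'b rel. is_aleph n s \<and> r =o cardSuc s)"


lemma least_card_ex:
  assumes "P A0"
  shows "\<exists>A. P A \<and> (\<forall>B. P B \<longrightarrow> |A| \<le>o |B| )"
proof -
  have "\<exists>r \<in> card_of ` Collect P. \<forall>r' \<in> card_of ` Collect P. r \<le>o r'"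
    by (rule exists_minim_Card_order) (use assms card_of_Card_order in blast)+
  then show ?thesis by auto
qed

lemma least_card_attained:
  assumes "P A0"
  shows "\<exists>A. P A \<and> least_card P = |A|"
  using someI_ex[OF least_card_ex[of P, OF assms]] unfolding least_card_def by blast

lemma least_card_le: "P B \<Longrightarrow> least_card P \<le>o |B|"
  using someI_ex[OF least_card_ex[of P B]] unfolding least_card_def by blast

lemma base_of_ex: "\<exists>\<B>. base_of X \<B>"
  by (rule exI[of _ "{U. openin X U}"]) (auto simp: base_of_def)

lemma Polish_partition_ex:
  fixes X :: "'a topology"
  assumes "completely_metrizable_space X"
  shows "\<exists>\<P>. Polish_partition X \<P>"
proof -
  have "Polish_space (subtopology X {x})" if x: "x \<in> topspace X" for x
  proof -
    have "Hausdorff_space X"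
      using assms completely_metrizable_imp_metrizable_space metrizable_imp_Hausdorff_space by blast
    then have "subtopology X {x} = discrete_topology {x}"
      using x by (intro finite_topspace_imp_discrete_topology)
        (auto simp: Hausdorff_space_subtopology)
    then show ?thesis
      by (simp add: Polish_space_def separable_space_discrete_topology
          completely_metrizable_space_discrete_topology)
  qed
  then show ?thesis
    by (intro exI[of _ "(\<lambda>x. {x}) ` topspace X"])
      (auto simp: Polish_partition_def Polish_cover_def disjoint_def)
qed

lemma Polish_cover_ex: "completely_metrizable_space X \<Longrightarrow> \<exists>\<C>. Polish_cover X \<C>"
  using Polish_partition_ex Polish_partition_def by blast

lemma is_aleph_Card_order: "is_aleph n r \<Longrightarrow> Card_order r"
proof (induction n arbitrary: r)
  case 0
  then show ?case
    unfolding is_aleph.simps using natLeq_Card_order Card_order_ordIso by blast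
next
  case (Suc n)
  then show ?case
    unfolding is_aleph.simps using cardSuc_Card_order Card_order_ordIso by blast
qed

lemma is_aleph_unique:
  fixes r :: "'b rel" and s :: "'c rel"
  assumes "is_aleph n r" "is_aleph n s"
  shows "r =o s"
  using assms
proof (induction n arbitrary: r s)
  case 0
  then show ?case
    unfolding is_aleph.simps using ordIso_symmetric ordIso_transitive by blast
next
  case (Suc n)
  obtain r' :: "'b rel" where r': "is_aleph n r'" "r =o cardSuc r'"
    using Suc.prems(1) unfolding is_aleph.simps by blast
  obtain s' :: "'c rel" where s': "is_aleph n s'" "s =o cardSuc s'"
    using Suc.prems(2) unfolding is_aleph.simps by blast
  have "cardSuc r' =o cardSuc s'"
    using Suc.IH[OF r'(1) s'(1)]
      cardSuc_invar_ordIso[OF is_aleph_Card_order[OF r'(1)] is_aleph_Card_order[OF s'(1)]]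
    by blast
  then show ?case
    by (rule ordIso_transitive[OF r'(2) ordIso_transitive[OF _ ordIso_symmetric[OF s'(2)]]])
qed

lemma is_aleph_pred_transfer:
  fixes r :: "'b rel" and s :: "'c rel"
  assumes "is_aleph n s" "r =o cardSuc s"
  shows "\<exists>s' :: 'b rel. s =o s'"
proof -
  have "s <o r"
    by (rule ordLess_ordIso_trans[OF cardSuc_greater[OF is_aleph_Card_order[OF assms(1)]]
          ordIso_symmetric[OF assms(2)]])
  then show ?thesis
    using internalize_ordLess[of s r] by blast
qed

lemma is_aleph_ordIso:
  fixes r :: "'b rel" and s :: "'c rel"
  assumes "is_aleph n r" "r =o s"
  shows "is_aleph n s"
  using assms
proof (induction n arbitrary: r s)
  case 0
  then show ?case
    unfolding is_aleph.simps using ordIso_symmetric ordIso_transitive by blast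
next
  case (Suc n)
  obtain r' :: "'b rel" where r': "is_aleph n r'" "r =o cardSuc r'"
    using Suc.prems(1) unfolding is_aleph.simps by blast
  have s: "s =o cardSuc r'"
    by (rule ordIso_transitive[OF ordIso_symmetric[OF Suc.prems(2)] r'(2)])
  obtain s' :: "'c rel" where s': "r' =o s'"
    using is_aleph_pred_transfer[OF r'(1) s] by blast
  have al: "is_aleph n s'"
    by (rule Suc.IH[OF r'(1) s'])
  have "cardSuc r' =o cardSuc s'"
    using s' cardSuc_invar_ordIso[OF is_aleph_Card_order[OF r'(1)] is_aleph_Card_order[OF al]]
    by blast
  then have "s =o cardSuc s'"
    by (rule ordIso_transitive[OF s])
  then show ?case
    unfolding is_aleph.simps using al by blast
qed

lemma is_aleph_cardSuc:
  fixes r :: "'b rel" and s :: "'c rel"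
  assumes "is_aleph n s" "r =o cardSuc s"
  shows "is_aleph (Suc n) r"
proof -
  obtain s' :: "'b rel" where s': "s =o s'"
    using is_aleph_pred_transfer[OF assms] by blast
  have al: "is_aleph n s'"
    by (rule is_aleph_ordIso[OF assms(1) s'])
  have "cardSuc s =o cardSuc s'"
    using s' cardSuc_invar_ordIso[OF is_aleph_Card_order[OF assms(1)] is_aleph_Card_order[OF al]]
    by blast
  then have "r =o cardSuc s'"
    by (rule ordIso_transitive[OF assms(2)])
  then show ?thesis
    unfolding is_aleph.simps using al by blast
qed

end

theory Submission
  imports Defs "HOL-Library.Countable_Set_Type"
begin

text \<open>
  A dense set of cardinality \<open>\<kappa>\<close> in a metrizable space yields a base of cardinality at most
  \<open>\<kappa> \<cdot> \<aleph>\<^sub>0\<close>, so covering the space by fewer than \<open>\<aleph>\<^sub>n\<close> Polish subspaces would make its weight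
  smaller than \<open>\<aleph>\<^sub>n\<close>.

  Conversely, by induction on \<open>n\<close>, a completely metrizable space \<open>Y\<close> contained in the closure of a
  set \<open>D\<close> of cardinality \<open>\<aleph>\<^sub>n\<close> splits into \<open>\<aleph>\<^sub>n\<close> Polish pieces: well-order \<open>D\<close> in type \<open>\<omega>\<^sub>n\<close> and
  cut \<open>Y\<close> into the sets \<open>Y\<^sub>a\<close> of those points that lie in the closure of \<open>{b. b < a}\<close> but not in
  the closure of \<open>{b. b < c}\<close> for any \<open>c < a\<close>. As every point is in the closure of a countable
  subset of \<open>D\<close>, which is bounded, these sets cover \<open>Y\<close>. If \<open>Y\<^sub>a\<close> is nonempty, then \<open>a\<close> has
  countable cofinality, whence \<open>Y\<^sub>a\<close> is a \<open>G\<^sub>\<delta>\<close> in \<open>Y\<close>, and it is contained in the closure of fewer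
  than \<open>\<aleph>\<^sub>n\<close> points.
\<close>

section \<open>Infinite cardinals and countable sets\<close>

lemma natLeq_le_is_aleph:
  fixes s :: "'b rel"
  shows "is_aleph n s \<Longrightarrow> natLeq \<le>o s"
proof (induction n arbitrary: s)
  case 0
  then show ?case
    by (simp add: ordIso_iff_ordLeq)
next
  case (Suc n)
  obtain t :: "'b rel" where t: "is_aleph n t" "s =o cardSuc t"
    using Suc.prems unfolding is_aleph.simps by blast
  have "t \<le>o cardSuc t"
    using cardSuc_greater[OF is_aleph_Card_order[OF t(1)]] ordLess_imp_ordLeq by blast
  then show ?case
    using Suc.IH[OF t(1)] t(2) ordLeq_transitive ordIso_symmetric ordLeq_ordIso_trans by blast
qed

lemma infinite_Field_if_natLeq_le:
  assumes "natLeq \<le>o s"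
  shows "infinite (Field s)"
proof -
  have "|Field natLeq| \<le>o |Field s|"
    using assms card_of_mono2 by blast
  then show ?thesis
    by (metis Field_natLeq card_of_ordLeq_infinite infinite_UNIV_nat)
qed

lemma countable_ordLeq:
  assumes "natLeq \<le>o s" "countable A"
  shows "|A| \<le>o s"
  using assms countable_card_le_natLeq ordLeq_transitive by blast

section \<open>Bases, closures and G-delta sets in metrizable spaces\<close>

text \<open>Traces on \<open>Y\<close> of the balls of radius \<open>inverse (Suc k)\<close> around
  points of \<open>D\<close> form the base. \<open>D\<close> may lie outside \<open>Y\<close>, so
  the bound passes to pieces of a space that miss the approximating points.\<close>

lemma base_of_closure:
  assumes "metrizable_space X" and Y: "Y \<subseteq> X closure_of D"
    and "|D| \<le>o s" "Card_order s" "natLeq \<le>o s"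
  shows "\<exists>\<B>. base_of (subtopology X Y) \<B> \<and> |\<B>| \<le>o s"
proof -
  obtain M d where "Metric_space M d" and X: "X = Metric_space.mtopology M d"
    using assms(1) metrizable_space_def by blast
  interpret Metric_space M d by fact
  define f where "f = (\<lambda>(a, k::nat). mball a (inverse (Suc k)) \<inter> Y)"
  have "base_of (subtopology X Y) (f ` (D \<times> UNIV))"
    unfolding base_of_def
  proof (intro conjI allI impI ballI)
    fix V assume "V \<in> f ` (D \<times> UNIV)"
    then show "openin (subtopology X Y) V"
      unfolding f_def X openin_subtopology by auto
  next
    fix U x assume "openin (subtopology X Y) U \<and> x \<in> U"
    then obtain T where T: "openin mtopology T" "U = T \<inter> Y" "x \<in> T" "x \<in> Y"
      unfolding openin_subtopology X by auto
    obtain r where r: "r > 0" "mball x r \<subseteq> T"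
      using T openin_mtopology by blast
    \<comment> \<open>Half of \<open>r\<close> suffices: a ball of this radius that contains
      \<open>x\<close> has diameter below \<open>r\<close>, hence lies in
      \<open>mball x r\<close>.\<close>
    obtain k where k: "inverse (real (Suc k)) < r / 2"
      using r(1) reals_Archimedean[of "r / 2"] by auto
    have "x \<in> mtopology closure_of D"
      using T(4) Y X by auto
    then have "\<forall>r>0. \<exists>y\<in>D. y \<in> mball x r"
      unfolding metric_closure_of by simp
    moreover have "0 < inverse (real (Suc k))"
      by simp
    ultimately obtain a where a: "a \<in> D" "a \<in> mball x (inverse (Suc k))"
      by blast
    have "mball a (inverse (Suc k)) \<subseteq> mball x r"
    proof
      fix y assume y: "y \<in> mball a (inverse (Suc k))"
      have "d x y \<le> d x a + d a y"
        using y a(2) by (intro triangle) auto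
      then show "y \<in> mball x r"
        using y a(2) k by auto
    qed
    moreover have "x \<in> mball a (inverse (Suc k))"
      using a(2) by (auto simp: commute)
    ultimately have "x \<in> f (a, k) \<and> f (a, k) \<subseteq> U"
      using r T by (auto simp: f_def)
    then show "\<exists>V \<in> f ` (D \<times> UNIV). x \<in> V \<and> V \<subseteq> U"
      using a(1) by blast
  qed
  moreover have "|D \<times> (UNIV :: nat set)| \<le>o s"
    using assms(3-) infinite_Field_if_natLeq_le[OF assms(5)]
      countable_ordLeq[OF assms(5), of "UNIV :: nat set"]
    by (intro card_of_Times_ordLeq_infinite_Field) auto
  then have "|f ` (D \<times> UNIV)| \<le>o s"
    using card_of_image ordLeq_transitive by blast
  ultimately show ?thesis
    by blast
qed

lemma closure_of_countable_subset:
  assumes "metrizable_space X" "x \<in> X closure_of D"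
  obtains S where "countable S" "S \<subseteq> D" "x \<in> X closure_of S"
proof -
  obtain M d where "Metric_space M d" and X: "X = Metric_space.mtopology M d"
    using assms(1) metrizable_space_def by blast
  interpret Metric_space M d by fact
  obtain \<sigma> :: "nat \<Rightarrow> 'a" where \<sigma>: "range \<sigma> \<subseteq> D \<inter> M" "limitin mtopology \<sigma> x sequentially" "x \<in> M"
    using assms(2) unfolding X closure_of_sequentially by blast
  have "x \<in> mtopology closure_of (range \<sigma>)"
    unfolding closure_of_sequentially using \<sigma> by blast
  then show ?thesis
    using that[of "range \<sigma>"] \<sigma>(1) X by auto
qed

text \<open>Closed sets of a metrizable space are G-delta, and a countable union of closed sets is
  F-sigma.\<close>

lemma gdelta_in_closure_of_diff:
  assumes "metrizable_space X" "countable S"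
  shows "gdelta_in (subtopology X Y) (Y \<inter> X closure_of A - (\<Union>b\<in>S. X closure_of F b))"
proof -
  have "gdelta_in X (X closure_of A - (\<Union>b\<in>S. X closure_of F b))"
  proof (rule gdelta_in_diff)
    show "gdelta_in X (X closure_of A)"
      using assms(1) by (simp add: closed_imp_gdelta_in)
    show "fsigma_in X (\<Union>b\<in>S. X closure_of F b)"
      using assms(2) by (intro fsigma_in_Union) (auto intro: closed_imp_fsigma_in)
  qed
  then show ?thesis
    unfolding gdelta_in_subtopology by blast
qed

section \<open>Regularity of successor cardinals\<close>

text \<open>Initial segments of \<open>r\<close> have at most \<open>t\<close> elements, hence so
  does a union of countably many of them, and some \<open>a\<close> lies outside it. By totality
  \<open>a\<close> is above all of \<open>S\<close>.\<close>

lemma countable_bounded: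
  assumes r: "Card_order r" "r =o cardSuc t" and t: "Card_order t" "natLeq \<le>o t"
    and S: "countable S" "S \<subseteq> Field r"
  obtains a where "a \<in> Field r" "S \<subseteq> underS r a"
proof -
  have le: "|under r b| \<le>o t" if "b \<in> Field r" for b
  proof -
    have "|underS r b| <o cardSuc t"
      using card_of_underS[OF r(1) that] r(2) ordLess_ordIso_trans by blast
    then have "|underS r b| \<le>o t"
      using cardSuc_ordLeq_ordLess[OF t(1) card_of_Card_order] by blast
    moreover have "|{b}| \<le>o t"
      by (rule countable_ordLeq[OF t(2)]) simp
    ultimately have "|underS r b \<union> {b}| \<le>o t"
      using card_of_Un_ordLeq_infinite_Field[OF infinite_Field_if_natLeq_le[OF t(2)]] t(1) by blast
    moreover have "under r b \<subseteq> underS r b \<union> {b}"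
      by (auto simp: under_def underS_def)
    ultimately show ?thesis
      using card_of_mono1 ordLeq_transitive by blast
  qed
  have "|\<Union>b\<in>S. under r b| \<le>o t"
    using S le t infinite_Field_if_natLeq_le[OF t(2)]
    by (intro card_of_UNION_ordLeq_infinite_Field countable_ordLeq) auto
  then have less: "|\<Union>b\<in>S. under r b| <o r"
    using cardSuc_ordLeq_ordLess[OF t(1) card_of_Card_order] ordLess_ordIso_trans
      ordIso_symmetric[OF r(2)] by blast
  have "\<not> Field r \<subseteq> (\<Union>b\<in>S. under r b)"
  proof
    assume "Field r \<subseteq> (\<Union>b\<in>S. under r b)"
    then have "|Field r| \<le>o |\<Union>b\<in>S. under r b|"
      by (rule card_of_mono1)
    then have "r \<le>o |\<Union>b\<in>S. under r b|"
      using card_of_Field_ordIso[OF r(1)] ordIso_symmetric ordIso_ordLeq_trans by blast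
    then show False
      using less not_ordLess_ordLeq by blast
  qed
  then obtain a where a: "a \<in> Field r" "\<And>b. b \<in> S \<Longrightarrow> (a, b) \<notin> r"
    by (auto simp: under_def)
  have tot: "Total r" and refl: "Refl r"
    using r(1) unfolding card_order_on_def well_order_on_def linear_order_on_def
      partial_order_on_def preorder_on_def by auto
  have "S \<subseteq> underS r a"
  proof
    fix b assume b: "b \<in> S"
    then have "b \<in> Field r" using S(2) by blast
    then have "b \<noteq> a" "(b, a) \<in> r"
      using a(1) a(2)[OF b] tot refl unfolding total_on_def refl_on_def by metis+
    then show "b \<in> underS r a"
      by (simp add: underS_def)
  qed
  then show ?thesis
    using that a(1) by blast
qed

section \<open>Gluing covers and partitions of pieces\<close>

lemma Polish_cover_UN:
  assumes "\<And>a. a \<in> I \<Longrightarrow> Polish_cover (subtopology X (Z a)) (\<P> a)"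
    and "\<And>a. a \<in> I \<Longrightarrow> Z a \<subseteq> Y"
    and "Y \<inter> topspace X \<subseteq> (\<Union>a\<in>I. Z a)"
  shows "Polish_cover (subtopology X Y) (\<Union>a\<in>I. \<P> a)"
  unfolding Polish_cover_def
proof (intro conjI ballI)
  fix C assume "C \<in> (\<Union>a\<in>I. \<P> a)"
  then obtain a where a: "a \<in> I" "C \<in> \<P> a" by blast
  then have C: "C \<subseteq> topspace X \<inter> Z a" "Polish_space (subtopology (subtopology X (Z a)) C)"
    using assms(1)[OF a(1)] unfolding Polish_cover_def by auto
  then show "C \<subseteq> topspace (subtopology X Y)"
    using assms(2)[OF a(1)] by auto
  have "Z a \<inter> C = C" "Y \<inter> C = C"
    using C(1) assms(2)[OF a(1)] by auto
  then show "Polish_space (subtopology (subtopology X Y) C)"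
    using C(2) by (simp add: subtopology_subtopology)
next
  have "\<Union>(\<Union>a\<in>I. \<P> a) = (\<Union>a\<in>I. \<Union>(\<P> a))"
    by blast
  also have "\<dots> = (\<Union>a\<in>I. topspace X \<inter> Z a)"
    using assms(1) unfolding Polish_cover_def by (intro SUP_cong) auto
  also have "\<dots> = topspace (subtopology X Y)"
    using assms(2,3) by auto
  finally show "\<Union>(\<Union>a\<in>I. \<P> a) = topspace (subtopology X Y)" .
qed

lemma Polish_partition_UN:
  assumes P: "\<And>a. a \<in> I \<Longrightarrow> Polish_partition (subtopology X (Z a)) (\<P> a)"
    and Z: "\<And>a. a \<in> I \<Longrightarrow> Z a \<subseteq> Y" "Y \<inter> topspace X \<subseteq> (\<Union>a\<in>I. Z a)"
    and disj: "\<And>a b. a \<in> I \<Longrightarrow> b \<in> I \<Longrightarrow> a \<noteq> b \<Longrightarrow> Z a \<inter> Z b = {}"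
  shows "Polish_partition (subtopology X Y) (\<Union>a\<in>I. \<P> a)"
  unfolding Polish_partition_def
proof
  show "Polish_cover (subtopology X Y) (\<Union>a\<in>I. \<P> a)"
    using P Z by (intro Polish_cover_UN[of I X Z \<P> Y]) (auto simp: Polish_partition_def)
  have sub: "C \<subseteq> Z a" if "a \<in> I" "C \<in> \<P> a" for C a
    using P[OF that(1)] that(2) unfolding Polish_partition_def Polish_cover_def by auto
  show "disjoint (\<Union>a\<in>I. \<P> a)"
  proof (rule disjointI)
    fix C C' assume "C \<in> (\<Union>a\<in>I. \<P> a)" "C' \<in> (\<Union>a\<in>I. \<P> a)" "C \<noteq> C'"
    then obtain a b where ab: "a \<in> I" "C \<in> \<P> a" "b \<in> I" "C' \<in> \<P> b" by blast
    show "C \<inter> C' = {}"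
    proof (cases "a = b")
      case True
      then show ?thesis
        using P[OF ab(1)] ab \<open>C \<noteq> C'\<close> unfolding Polish_partition_def disjoint_def by blast
    next
      case False
      then show ?thesis
        using disj[OF ab(1,3)] sub[OF ab(1,2)] sub[OF ab(3,4)] by blast
    qed
  qed
qed

section \<open>The upper bound by induction on \<open>n\<close>\<close>

lemma Polish_partition_card_le:
  fixes X :: "'a topology" and s :: "'b rel"
  assumes X: "metrizable_space X" and "completely_metrizable_space (subtopology X Y)"
    and "is_aleph n s" "|D| \<le>o s" "Y \<subseteq> X closure_of D"
  shows "\<exists>\<P>. Polish_partition (subtopology X Y) \<P> \<and> |\<P>| \<le>o s"
  using assms(2-)
proof (induction n arbitrary: s D Y)
  case 0
  \<comment> \<open>A countable base makes \<open>Y\<close> separable, so \<open>Y\<close> itself is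
    the only piece.\<close>
  have s: "s =o natLeq" using 0(2) by simp
  then have D: "|D| \<le>o natLeq"
    using 0(3) ordLeq_ordIso_trans by blast
  obtain \<B> where \<B>: "base_of (subtopology X Y) \<B>" "|\<B>| \<le>o natLeq"
    using base_of_closure[OF X 0(4) D natLeq_Card_order] ordIso_imp_ordLeq[OF natLeq_Card_order[THEN ordIso_refl]]
    by blast
  then have "second_countable (subtopology X Y)"
    unfolding second_countable_def base_of_def by (metis countable_card_le_natLeq)
  then have "separable_space (subtopology X Y)"
    by (rule second_countable_imp_separable_space)
  then have "Polish_partition (subtopology X Y) {topspace (subtopology X Y)}"
    using 0(1) by (auto simp: Polish_partition_def Polish_cover_def Polish_space_def disjoint_def
        simp del: topspace_subtopology)
  moreover have "|{topspace (subtopology X Y)}| \<le>o s"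
    using natLeq_le_is_aleph[OF 0(2)] by (rule countable_ordLeq) simp
  ultimately show ?case by blast
next
  case (Suc n)
  obtain t :: "'b rel" where t: "is_aleph n t" "s =o cardSuc t"
    using Suc.prems(2) unfolding is_aleph.simps by blast
  have Ct: "Card_order t" and nt: "natLeq \<le>o t"
    using is_aleph_Card_order[OF t(1)] natLeq_le_is_aleph[OF t(1)] .
  have Cs: "Card_order s" and ns: "natLeq \<le>o s"
    using is_aleph_Card_order[OF Suc.prems(2)] natLeq_le_is_aleph[OF Suc.prems(2)] .
  have "t <o s"
    using cardSuc_greater[OF Ct] ordIso_symmetric[OF t(2)] ordLess_ordIso_trans by blast
  then have ts: "t \<le>o s"
    by (rule ordLess_imp_ordLeq)
  show ?case
  \<comment> \<open>A small \<open>D\<close> is settled by the induction hypothesis; otherwise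
    \<open>D\<close> has cardinality exactly \<open>cardSuc t\<close>.\<close>
  proof (cases "|D| \<le>o t")
    case True
    then show ?thesis
      using Suc.IH[OF Suc.prems(1) t(1) True Suc.prems(4)] ts ordLeq_transitive by blast
  next
    case False
    then have "cardSuc t \<le>o |D|"
      using Ct card_of_Card_order cardSuc_ordLess_ordLeq not_ordLeq_iff_ordLess
      by (metis card_order_on_well_order_on card_of_Well_order)
    then have D: "|D| =o cardSuc t"
      using Suc.prems(3) t(2) ordLeq_ordIso_trans ordIso_iff_ordLeq by blast
    \<comment> \<open>The relation \<open>|D|\<close> is a well-order of \<open>D\<close> of least
      order type, so its proper initial segments have at most \<open>t\<close> elements.\<close>
    define r where "r = |D|"
    have r: "Card_order r" "Field r = D" "r =o cardSuc t"
      using D card_of_Card_order[of D] by (simp_all only: r_def Field_card_of)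
    have wo: "wo_rel r"
      using r(1) unfolding wo_rel_def card_order_on_def r(2) by simp
    define E where "E a = X closure_of (underS r a)" for a
    define Z where "Z a = Y \<inter> E a - (\<Union>b\<in>underS r a. E b)" for a
    have E_mono: "E b \<subseteq> E a" if "(b, a) \<in> r" for a b
      unfolding E_def using that wo
      by (intro closure_of_mono underS_incr) (simp_all add: wo_rel.TRANS wo_rel.ANTISYM)
    have Z_gdelta: "gdelta_in (subtopology X Y) (Z a)" if a: "a \<in> D" for a
    proof (cases "Z a = {}")
      case False
      then obtain x where x: "x \<in> Z a" by blast
      then have "x \<in> X closure_of (underS r a)"
        by (simp add: Z_def E_def)
      then obtain S where S: "countable S" "S \<subseteq> underS r a" "x \<in> X closure_of S"
        using closure_of_countable_subset[OF X] by metis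
      \<comment> \<open>If no element of \<open>S\<close> were at or above \<open>b\<close>, all of
        \<open>S\<close> would lie below \<open>b\<close>, giving \<open>x \<in> E b\<close>, which
        \<open>x \<in> Z a\<close> forbids. As \<open>E\<close> is monotone, the union removed in
        \<open>Z a\<close> is thus a countable one over \<open>S\<close>.\<close>
      have cofinal: "\<exists>c\<in>S. (b, c) \<in> r" if b: "b \<in> underS r a" for b
      proof (rule ccontr)
        assume neg: "\<not> (\<exists>c\<in>S. (b, c) \<in> r)"
        have bF: "b \<in> Field r"
          using b by (auto simp: underS_def Field_def)
        have "S \<subseteq> underS r b"
        proof
          fix c assume c: "c \<in> S"
          have cF: "c \<in> Field r"
            using c S(2) by (auto simp: underS_def Field_def)
          have "(c, b) \<in> r" "c \<noteq> b"
            using wo_rel.TOTALS[OF wo] neg c bF cF by blast+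
          then show "c \<in> underS r b"
            by (simp add: underS_def)
        qed
        then have "x \<in> E b"
          using S(3) closure_of_mono[of S "underS r b" X] unfolding E_def by blast
        then show False
          using x b by (auto simp: Z_def)
      qed
      have "(\<Union>b\<in>underS r a. E b) = (\<Union>b\<in>S. E b)"
        using cofinal E_mono S(2) by blast
      then show ?thesis
        using gdelta_in_closure_of_diff[OF X S(1)] by (simp add: Z_def E_def)
    qed simp
    have Z_sub: "Z a \<subseteq> Y" for a
      by (auto simp: Z_def)
    have "\<exists>\<P>. Polish_partition (subtopology X (Z a)) \<P> \<and> |\<P>| \<le>o t" if a: "a \<in> D" for a
    \<comment> \<open>The new approximating set is \<open>underS r a\<close>; complete metrizability
      passes to \<open>Z a\<close> because it is a G-delta.\<close>
    proof (rule Suc.IH[OF _ t(1)])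
      have "completely_metrizable_space (subtopology (subtopology X Y) (Z a))"
        using Suc.prems(1) Z_gdelta[OF a] by (rule completely_metrizable_space_gdelta_in)
      then show "completely_metrizable_space (subtopology X (Z a))"
        using Z_sub[of a] by (simp add: subtopology_subtopology Int_absorb1)
      have "|underS r a| <o cardSuc t"
        using card_of_underS[OF r(1)] a r(2,3) ordLess_ordIso_trans by blast
      then show "|underS r a| \<le>o t"
        using cardSuc_ordLeq_ordLess[OF Ct card_of_Card_order] by blast
      show "Z a \<subseteq> X closure_of (underS r a)"
        by (auto simp: Z_def E_def)
    qed
    then obtain \<P> where \<P>: "\<And>a. a \<in> D \<Longrightarrow> Polish_partition (subtopology X (Z a)) (\<P> a)"
      "\<And>a. a \<in> D \<Longrightarrow> |\<P> a| \<le>o t"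
      by metis
    have "Polish_partition (subtopology X Y) (\<Union>a\<in>D. \<P> a)"
    proof (rule Polish_partition_UN[OF \<P>(1) Z_sub])
      show "Y \<inter> topspace X \<subseteq> (\<Union>a\<in>D. Z a)"
      proof
        fix x assume "x \<in> Y \<inter> topspace X"
        then have x: "x \<in> Y" "x \<in> X closure_of D"
          using Suc.prems(4) by auto
        obtain S where S: "countable S" "S \<subseteq> D" "x \<in> X closure_of S"
          using closure_of_countable_subset[OF X x(2)] by metis
        obtain c where c: "c \<in> D" "S \<subseteq> underS r c"
          using countable_bounded[OF r(1,3) Ct nt S(1)] S(2) r(2) by metis
        have "x \<in> E c"
          using S(3) closure_of_mono[OF c(2)] unfolding E_def by blast
        then have "c \<in> {a \<in> D. x \<in> E a}"
          using c by simp
        \<comment> \<open>The least index whose \<open>E a\<close> contains \<open>x\<close> is the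
          index of the piece of \<open>x\<close>.\<close>
        from wo_rel.WF[OF wo] this obtain a where a: "a \<in> {a \<in> D. x \<in> E a}"
          "\<And>b. (b, a) \<in> r - Id \<Longrightarrow> b \<notin> {a \<in> D. x \<in> E a}"
          by (rule wfE_min) (rule that)
        have "x \<notin> E b" if "b \<in> underS r a" for b
          using a(2)[of b] that r(2) by (auto simp: underS_def Field_def)
        then have "x \<in> Z a"
          using x a(1) by (auto simp: Z_def)
        then show "x \<in> (\<Union>a\<in>D. Z a)"
          using a(1) by blast
      qed
      show "Z a \<inter> Z b = {}" if ab: "a \<in> D" "b \<in> D" "a \<noteq> b" for a b
      proof -
        \<comment> \<open>The piece with the larger index omits the whole \<open>E\<close> of the
          smaller one, which contains the other piece.\<close>
        have "a \<in> underS r b \<or> b \<in> underS r a"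
          using wo_rel.TOTALS[OF wo] ab r(2) by (auto simp: underS_def)
        then show ?thesis
          by (auto simp: Z_def)
      qed
    qed
    moreover have "|\<Union>a\<in>D. \<P> a| \<le>o s"
      using Suc.prems(3) Cs infinite_Field_if_natLeq_le[OF ns] ordLeq_transitive[OF \<P>(2) ts]
      by (intro card_of_UNION_ordLeq_infinite_Field) auto
    ultimately show ?thesis
      by blast
  qed
qed

section \<open>Weight, dense sets and the lower bound\<close>

lemma weight_dense:
  obtains D where "X closure_of D = topspace X" "|D| \<le>o weight X"
proof -
  obtain \<B> where \<B>: "base_of X \<B>" "weight X = |\<B>|"
    using base_of_ex[of X] least_card_attained[of "base_of X"] unfolding weight_def by blast
  \<comment> \<open>An arbitrary value at the empty set does no harm: the closure stays within
    \<open>topspace X\<close>.\<close>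
  define c where "c V = (SOME x. x \<in> V)" for V :: "'a set"
  have "x \<in> X closure_of (c ` \<B>)" if x: "x \<in> topspace X" for x
    unfolding in_closure_of
  proof (intro conjI allI impI x)
    fix T assume "x \<in> T \<and> openin X T"
    then obtain V where V: "V \<in> \<B>" "x \<in> V" "V \<subseteq> T"
      using \<B>(1) unfolding base_of_def by blast
    then have "c V \<in> T"
      unfolding c_def by (metis someI subsetD)
    then show "\<exists>y. y \<in> c ` \<B> \<and> y \<in> T"
      using V(1) by blast
  qed
  then have "X closure_of (c ` \<B>) = topspace X"
    using closure_of_subset_topspace[of X] by blast
  then show ?thesis
    using that[of "c ` \<B>"] \<B>(2) card_of_image by metis
qed

text \<open>Countable dense subsets of the members together form a dense set of at most
  \<open>s\<close> points, and \<open>base_of_closure\<close> turns it into a base.\<close>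

lemma weight_le_Polish_cover:
  assumes X: "metrizable_space X" and C: "Polish_cover X \<C>"
    and s: "|\<C>| \<le>o s" "Card_order s" "natLeq \<le>o s"
  shows "weight X \<le>o s"
proof -
  have "\<exists>A. countable A \<and> C \<subseteq> X closure_of A" if "C \<in> \<C>" for C
  proof -
    have "separable_space (subtopology X C)" "C \<subseteq> topspace X"
      using C that unfolding Polish_cover_def Polish_space_def by auto
    then show ?thesis
      unfolding separable_space_def closure_of_subtopology
      by (metis (no_types, lifting) inf.absorb_iff2 inf_le1 inf_le2 subset_trans topspace_subtopology
          closure_of_mono)
  qed
  then obtain A where A: "\<And>C. C \<in> \<C> \<Longrightarrow> countable (A C)" "\<And>C. C \<in> \<C> \<Longrightarrow> C \<subseteq> X closure_of (A C)"
    by metis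
  have "|\<Union>C\<in>\<C>. A C| \<le>o s"
    using s A(1) infinite_Field_if_natLeq_le[OF s(3)] countable_ordLeq[OF s(3)]
    by (intro card_of_UNION_ordLeq_infinite_Field) auto
  moreover have "topspace X \<subseteq> X closure_of (\<Union>C\<in>\<C>. A C)"
  proof
    fix x assume "x \<in> topspace X"
    then obtain C where C': "C \<in> \<C>" "x \<in> C"
      using C unfolding Polish_cover_def by blast
    then have "X closure_of (A C) \<subseteq> X closure_of (\<Union>C\<in>\<C>. A C)"
      by (intro closure_of_mono) blast
    then show "x \<in> X closure_of (\<Union>C\<in>\<C>. A C)"
      using A(2) C' by blast
  qed
  ultimately obtain \<B> where "base_of X \<B>" "|\<B>| \<le>o s"
    using base_of_closure[OF X, of "topspace X"] s by (metis subtopology_topspace)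
  then show ?thesis
    unfolding weight_def using least_card_le ordLeq_transitive by blast
qed

section \<open>Combining the two bounds\<close>

theorem theorem2p5:
  fixes X :: "'a topology" and n :: nat
  assumes "completely_metrizable_space X"
    and "n \<noteq> 0"
    and "is_aleph n (weight X)"
  shows "cov X =o par X \<and> is_aleph n (cov X) \<and> is_aleph n (par X)"
proof -
  have X: "metrizable_space X"
    using assms(1) by (rule completely_metrizable_imp_metrizable_space)
  obtain D where "X closure_of D = topspace X" "|D| \<le>o weight X"
    by (rule weight_dense)
  then obtain \<P> where "Polish_partition X \<P>" "|\<P>| \<le>o weight X"
    using Polish_partition_card_le[OF X, of "topspace X" n "weight X" D] assms(1,3) by auto
  then have par_le: "par X \<le>o weight X"
    unfolding par_def using least_card_le ordLeq_transitive by blast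
  obtain \<Q> where \<Q>: "Polish_partition X \<Q>" "par X = |\<Q>|"
    using Polish_partition_ex[OF assms(1)] least_card_attained[of "Polish_partition X"]
    unfolding par_def by blast
  have cov_le: "cov X \<le>o par X"
    unfolding \<Q>(2) cov_def using \<Q>(1) by (intro least_card_le) (simp add: Polish_partition_def)
  obtain \<C> where \<C>: "Polish_cover X \<C>" "cov X = |\<C>|"
    using Polish_cover_ex[OF assms(1)] least_card_attained[of "Polish_cover X"]
    unfolding cov_def by blast
  \<comment> \<open>The predecessor \<open>s\<close> of the weight is infinite, so a cover of size
    at most \<open>s\<close> would force the weight down to \<open>s\<close>.\<close>
  obtain m where "n = Suc m"
    using assms(2) not0_implies_Suc by blast
  then obtain s :: "'a set rel" where s: "is_aleph m s" "weight X =o cardSuc s"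
    using assms(3) by auto
  have Cs: "Card_order s" and ns: "natLeq \<le>o s"
    using is_aleph_Card_order[OF s(1)] natLeq_le_is_aleph[OF s(1)] .
  have "\<not> weight X \<le>o s"
    using cardSuc_greater[OF Cs] s(2) not_ordLess_ordLeq ordIso_symmetric ordIso_ordLeq_trans
    by blast
  then have "\<not> |\<C>| \<le>o s"
    using weight_le_Polish_cover[OF X \<C>(1) _ Cs ns] by blast
  then have "cardSuc s \<le>o |\<C>|"
    using Cs card_of_Card_order cardSuc_ordLess_ordLeq not_ordLeq_iff_ordLess
    by (metis card_order_on_well_order_on card_of_Well_order)
  then have weight_le: "weight X \<le>o cov X"
    unfolding \<C>(2) using s(2) ordIso_ordLeq_trans by blast
  have "weight X =o cov X" "weight X =o par X"
    using weight_le cov_le par_le ordLeq_transitive ordIso_iff_ordLeq by blast+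
  then show ?thesis
    using is_aleph_ordIso[OF assms(3)] ordIso_symmetric ordIso_transitive by blast
qed

end
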